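(* Let $f$ be a smooth vector field on $\mathbb{R}^n$, let $x_e\in\mathbb{R}^n$ satisfy $f(x_e)=0$, and let $C_1,\dots,C_k\in C^2(\mathbb{R}^n,\mathbb{R})$ be constants of motion for $\dot x=f(x)$. Fix $i\in\{1,\dots,k\}$. Then the following three statements are equivalent: (a) There exist real constants $\lambda_j^*$, $j\in\{1,\dots,k\}$, $j\neq i$, such that the function $F_i:=C_i-\sum_{j\neq i}\lambda_j^*C_j$ satisfies $\nabla F_i(x_e)=0$ and the restriction of the quadratic form of the Hessian $\nabla^2F_i(x_e)$ to $W\times W$ is positive definite or negative definite, where $W:=\bigcap_{j\neq i}\ker dC_j(x_e)$. (b) There exist functions $\varphi_j\in C^2(\mathbb{R},\mathbb{R})$, $j\in\{1,\dots,k\}$, $j\ne i$, such that the function $G:=C_i+\sum_{j\neq i}\varphi_j\circ C_j$ satisfies $\nabla G(x_e)=0$ and the Hessian $\nabla^2G(x_e)$ is positive definite or negative definite (on $\mathbb{R}^n$). (c) There exist functions $\varphi_j\in C^2(\mathbb{R},\mathbb{R})$, $j\in\{1,\dots,k\}$, $j\neq i$, such that the function $G:=C_i+\sum_{j\neq i}\varphi_j\circ C_j$ satisfies $\nabla G(x_e)=0$ and the restriction of the quadratic form of the Hessian $\nabla^2G(x_e)$ to $\widetilde W\times\widetilde W$ is positive definite or negative definite, where $\widetilde W:=\bigcap_{j\neq i}\ker d(\varphi_j\circ C_j)(x_e)$. Moreover, each of the statements (a), (b), (c) implies that $x_e$ is a nonlinearly stable equilibrium of $\dot x=f(x)$.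
   Context: A constant of motion for $\dot x=f(x)$ is a function $V:\mathbb{R}^n\to\mathbb{R}$ whose derivative along the trajectories vanishes, i.e. $dV(x)(f(x))=0$ for all $x\in\mathbb{R}^n$. Nonlinear stability of an equilibrium $x_e$ means stability in the sense of Lyapunov: for every neighborhood $U$ of $x_e$ there is a neighborhood $U'\subseteq U$ of $x_e$ such that every trajectory starting in $U'$ at time $0$ is defined and stays in $U$ for all $t\ge 0$. An intersection over an empty index set of subspaces of $\mathbb{R}^n$ is $\mathbb{R}^n$. *)

theory Defs
  imports "HOL-Analysis.Analysis"
begin

text \<open>\<open>C_class m F\<close>: \<open>F\<close> is of class \<open>C\<^sup>m\<close>. In finite dimension, continuity of the
  directional derivatives of order up to \<open>m\<close> in all fixed directions is the same as continuity
  of the Frechet derivatives up to that order.\<close>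

primrec C_class :: "nat \<Rightarrow> ('a::euclidean_space \<Rightarrow> 'b::real_normed_vector) \<Rightarrow> bool" where
  "C_class 0 F \<longleftrightarrow> continuous_on UNIV F"
| "C_class (Suc m) F \<longleftrightarrow> (\<forall>x. F differentiable (at x)) \<and>
     (\<forall>v. C_class m (\<lambda>x. frechet_derivative F (at x) v))"

definition smooth :: "('a::euclidean_space \<Rightarrow> 'b::real_normed_vector) \<Rightarrow> bool" where
  "smooth F \<longleftrightarrow> (\<forall>m. C_class m F)"

definition partial :: "'n \<Rightarrow> (real^'n \<Rightarrow> real) \<Rightarrow> real^'n \<Rightarrow> real" where
  "partial a F x = frechet_derivative F (at x) (axis a 1)"

definition hessian :: "(real^'n \<Rightarrow> real) \<Rightarrow> real^'n \<Rightarrow> real^'n^'n" where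
  "hessian F x = (\<chi> a b. partial a (partial b F) x)"

definition ker_d :: "(real^'n \<Rightarrow> real) \<Rightarrow> real^'n \<Rightarrow> (real^'n) set" where
  "ker_d F x = {v. frechet_derivative F (at x) v = 0}"

definition pos_def_on :: "(real^'n) set \<Rightarrow> real^'n^'n \<Rightarrow> bool" where
  "pos_def_on W H \<longleftrightarrow> (\<forall>v\<in>W. v \<noteq> 0 \<longrightarrow> v \<bullet> (H *v v) > 0)"

definition neg_def_on :: "(real^'n) set \<Rightarrow> real^'n^'n \<Rightarrow> bool" where
  "neg_def_on W H \<longleftrightarrow> (\<forall>v\<in>W. v \<noteq> 0 \<longrightarrow> v \<bullet> (H *v v) < 0)"

definition constant_of_motion :: "(real^'n \<Rightarrow> real^'n) \<Rightarrow> (real^'n \<Rightarrow> real) \<Rightarrow> bool" where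
  "constant_of_motion f V \<longleftrightarrow>
     (\<forall>x. V differentiable (at x) \<and> frechet_derivative V (at x) (f x) = 0)"

definition solution_on :: "(real^'n \<Rightarrow> real^'n) \<Rightarrow> real set \<Rightarrow> (real \<Rightarrow> real^'n) \<Rightarrow> bool" where
  "solution_on f J x \<longleftrightarrow> is_interval J \<and> 0 \<in> J \<and>
     (\<forall>t\<in>J. (x has_vector_derivative f (x t)) (at t within J))"

text \<open>A trajectory is a maximal solution; only its values on \<open>J\<close> matter. Since \<open>J = {0}\<close> is
  admissible in \<open>solution_on\<close>, Zorn's lemma yields a trajectory through every initial
  point, so a universal statement about trajectories is never vacuous.\<close>

definition trajectory :: "(real^'n \<Rightarrow> real^'n) \<Rightarrow> real set \<Rightarrow> (real \<Rightarrow> real^'n) \<Rightarrow> bool" where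
  "trajectory f J x \<longleftrightarrow> solution_on f J x \<and>
     (\<forall>J' y. solution_on f J' y \<and> J \<subseteq> J' \<and> (\<forall>t\<in>J. y t = x t) \<longrightarrow> J' = J)"

text \<open>Neighborhoods are not required to be open.\<close>

definition nonlinearly_stable_equilibrium ::
    "(real^'n \<Rightarrow> real^'n) \<Rightarrow> real^'n \<Rightarrow> bool" where
  "nonlinearly_stable_equilibrium f xe \<longleftrightarrow> f xe = 0 \<and>
     (\<forall>U. xe \<in> interior U \<longrightarrow>
        (\<exists>U'. U' \<subseteq> U \<and> xe \<in> interior U' \<and>
           (\<forall>J x. trajectory f J x \<and> x 0 \<in> U' \<longrightarrow>
              {0..} \<subseteq> J \<and> (\<forall>t\<ge>0. x t \<in> U))))"

text \<open>In the following conditions the functions are \<open>C 1, \<dots>, C k\<close>; values of \<open>lam\<close> and \<open>\<phi>\<close>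
  outside \<open>{1..k} - {i}\<close> play no role, and for \<open>k = 1\<close> the intersections are \<open>UNIV\<close>.\<close>

definition condition_a ::
    "(nat \<Rightarrow> real^'n \<Rightarrow> real) \<Rightarrow> nat \<Rightarrow> nat \<Rightarrow> real^'n \<Rightarrow> bool" where
  "condition_a C k i xe \<longleftrightarrow>
     (\<exists>lam :: nat \<Rightarrow> real.
        let F = (\<lambda>x. C i x - (\<Sum>j\<in>{1..k} - {i}. lam j * C j x));
            W = (\<Inter>j\<in>{1..k} - {i}. ker_d (C j) xe)
        in (GDERIV F xe :> 0) \<and>
           (pos_def_on W (hessian F xe) \<or> neg_def_on W (hessian F xe)))"

definition condition_b ::
    "(nat \<Rightarrow> real^'n \<Rightarrow> real) \<Rightarrow> nat \<Rightarrow> nat \<Rightarrow> real^'n \<Rightarrow> bool" where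
  "condition_b C k i xe \<longleftrightarrow>
     (\<exists>\<phi> :: nat \<Rightarrow> real \<Rightarrow> real. (\<forall>j\<in>{1..k} - {i}. C_class 2 (\<phi> j)) \<and>
       (let G = (\<lambda>x. C i x + (\<Sum>j\<in>{1..k} - {i}. (\<phi> j \<circ> C j) x))
        in (GDERIV G xe :> 0) \<and>
           (pos_def_on UNIV (hessian G xe) \<or> neg_def_on UNIV (hessian G xe))))"

definition condition_c ::
    "(nat \<Rightarrow> real^'n \<Rightarrow> real) \<Rightarrow> nat \<Rightarrow> nat \<Rightarrow> real^'n \<Rightarrow> bool" where
  "condition_c C k i xe \<longleftrightarrow>
     (\<exists>\<phi> :: nat \<Rightarrow> real \<Rightarrow> real. (\<forall>j\<in>{1..k} - {i}. C_class 2 (\<phi> j)) \<and>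
       (let G = (\<lambda>x. C i x + (\<Sum>j\<in>{1..k} - {i}. (\<phi> j \<circ> C j) x));
            W = (\<Inter>j\<in>{1..k} - {i}. ker_d (\<phi> j \<circ> C j) xe)
        in (GDERIV G xe :> 0) \<and>
           (pos_def_on W (hessian G xe) \<or> neg_def_on W (hessian G xe))))"

end

theory Submission imports Defs begin

text \<open>
  The equivalence is a statement about 2-jets at \<open>xe\<close>. Write \<open>p j\<close> for the gradient of \<open>C j\<close> and
  \<open>P j\<close> for the derivative of \<open>p j\<close> at \<open>xe\<close>, that is, the Hessian. For \<open>G = C i + (\<Sum>j. \<phi> j \<circ> C j)\<close>
  the chain rule gives, with \<open>a j = \<phi>' j (C j xe)\<close> and \<open>b j = \<phi>'' j (C j xe)\<close>,
  the gradient \<open>p i + (\<Sum>j. a j *\<^sub>R p j)\<close> and the Hessian form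
  \<open>P i v \<bullet> v + (\<Sum>j. a j * (P j v \<bullet> v) + b j * (v \<bullet> p j)\<^sup>2)\<close> at \<open>xe\<close>.
  So only the numbers \<open>a j\<close> and \<open>b j\<close> matter, and quadratic polynomials \<open>\<phi> j\<close> realise all of
  them. Condition (a) is the case \<open>b = 0\<close>, \<open>a = - lam\<close>.

  In these terms (b) implies (c) because definiteness passes to subspaces. (c) implies (a) because
  a vector orthogonal to every \<open>p j\<close> lies in the subspace of (c), and on such vectors the
  \<open>b\<close>-terms vanish. (a) implies (b) by a compactness argument (lemma \<open>finsler\<close>): a
  quadratic form that is positive on the common kernel of the functionals \<open>v \<bullet> p j\<close> becomes
  positive everywhere once a large multiple of \<open>\<Sum>j. (v \<bullet> p j)\<^sup>2\<close> is added to it. The multiple,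
  with a minus sign in the negative definite case, is the common value of the \<open>b j\<close>.

  For stability, \<open>G\<close> from (b) is itself a constant of motion, since its gradient is
  at each point a combination of the gradients of the \<open>C j\<close>, and \<open>\<plusminus>G\<close> has a strict local minimum at
  \<open>xe\<close>. A trajectory that starts near \<open>xe\<close> at a level of \<open>\<plusminus>G\<close> below the minimum
  over a small sphere cannot cross that sphere. Being confined to a compact ball, it exists for all positive time: such a
  solution on a bounded time interval has a limit at the right end, and Picard's theorem continues it
  beyond (lemma \<open>bounded_trajectory_global\<close>).
\<close>

section \<open>Existence and continuation of solutions\<close>

text \<open>Picard iteration. Composing \<open>f\<close> with the projection onto the ball makes it globally Lipschitz
  and bounded, so that the integral operator is defined on a whole Banach space of bounded continuous
  functions; its fixed point stays in the ball, where the projection does nothing.\<close>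

lemma picard_existence:
  fixes f :: "'a::euclidean_space \<Rightarrow> 'a"
  assumes "r > 0" and lip: "L-lipschitz_on (cball y0 r) f"
  obtains e z where "e > 0" and "z s = y0"
    and "\<And>t. t \<in> {s..s+e} \<Longrightarrow> (z has_vector_derivative f (z t)) (at t within {s..s+e})"
proof -
  have "L \<ge> 0" using lip lipschitz_on_nonneg by blast
  define g where "g = (\<lambda>y. f (closest_point (cball y0 r) y))"
  have in_ball: "closest_point (cball y0 r) y \<in> cball y0 r" for y
    using \<open>r > 0\<close> by (intro closest_point_in_set) auto
  have g_lip: "dist (g y) (g y') \<le> L * dist y y'" for y y'
  proof -
    have "dist (g y) (g y') \<le> L * dist (closest_point (cball y0 r) y) (closest_point (cball y0 r) y')"
      unfolding g_def using lipschitz_onD[OF lip in_ball in_ball] .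
    also have "\<dots> \<le> L * dist y y'"
      using \<open>r > 0\<close> \<open>L \<ge> 0\<close> by (intro mult_left_mono closest_point_lipschitz) auto
    finally show ?thesis .
  qed
  have g_cont: "continuous_on A g" for A
    by (rule lipschitz_on_continuous_on[of L]) (auto simp: lipschitz_on_def \<open>L \<ge> 0\<close> g_lip)
  define M where "M = norm (f y0) + L * r + 1"
  have "M > 0" unfolding M_def using \<open>r > 0\<close> \<open>L \<ge> 0\<close> by (simp add: add_nonneg_pos)
  have g_bound: "norm (g y) \<le> M" for y
  proof -
    have "dist (g y) (f y0) \<le> L * dist (closest_point (cball y0 r) y) y0"
      unfolding g_def using \<open>r > 0\<close> by (intro lipschitz_onD[OF lip] in_ball) auto
    also have "\<dots> \<le> L * r"
      using in_ball[of y] \<open>L \<ge> 0\<close> by (intro mult_left_mono) (auto simp: dist_commute)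
    finally show ?thesis
      unfolding M_def using norm_triangle_sub[of "g y" "f y0"] by (simp add: dist_norm)
  qed
  \<comment> \<open>The first bound keeps the solution in the ball, the second makes the operator contract
    distances by the factor \<open>1/2\<close>.\<close>
  define e where "e = min (r / M) (1 / (2 * (L + 1)))"
  have "e > 0" unfolding e_def using \<open>r > 0\<close> \<open>M > 0\<close> \<open>L \<ge> 0\<close> by simp
  have eM: "e * M \<le> r"
    unfolding e_def using \<open>M > 0\<close> by (simp add: min_def field_simps)
  have eL: "e * L \<le> 1/2"
  proof -
    have "e * L \<le> (1 / (2 * (L + 1))) * L"
      unfolding e_def using \<open>L \<ge> 0\<close> by (intro mult_right_mono) auto
    also have "\<dots> \<le> 1/2" using \<open>L \<ge> 0\<close> by (simp add: field_simps)
    finally show ?thesis .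
  qed
  \<comment> \<open>Freezing the upper limit of integration outside \<open>{s..s+e}\<close> makes the operator act on
    functions on the whole line.\<close>
  define cl where "cl = (\<lambda>t. max s (min (s + e) t))"
  have cl: "cl t \<in> {s..s+e}" for t unfolding cl_def using \<open>e > 0\<close> by auto
  define Q where "Q = (\<lambda>u t. y0 + integral {s..cl t} (\<lambda>\<tau>. g (u \<tau>)))"
  have gu_cont: "continuous_on A (\<lambda>\<tau>. g (apply_bcontfun u \<tau>))" for A and u :: "real \<Rightarrow>\<^sub>C 'a"
    by (rule continuous_on_compose2[OF g_cont[of UNIV]]) auto
  have int_bound: "norm (integral {s..cl t} (\<lambda>\<tau>. g (apply_bcontfun u \<tau>))) \<le> e * M"
    for t and u :: "real \<Rightarrow>\<^sub>C 'a"
  proof -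
    have "norm (integral {s..cl t} (\<lambda>\<tau>. g (apply_bcontfun u \<tau>))) \<le> M * (cl t - s)"
      using cl[of t] by (intro integral_bound gu_cont g_bound) auto
    also have "\<dots> \<le> M * e" using cl[of t] \<open>M > 0\<close> by (intro mult_left_mono) auto
    finally show ?thesis by (simp add: mult.commute)
  qed
  have Q_bcont: "Q (apply_bcontfun u) \<in> bcontfun" for u :: "real \<Rightarrow>\<^sub>C 'a"
  proof -
    have "continuous_on {s..s+e} (\<lambda>t. integral {s..t} (\<lambda>\<tau>. g (apply_bcontfun u \<tau>)))"
      by (intro indefinite_integral_continuous_1 integrable_continuous_real gu_cont)
    then have "continuous_on UNIV (\<lambda>t. integral {s..cl t} (\<lambda>\<tau>. g (apply_bcontfun u \<tau>)))"
      by (rule continuous_on_compose2) (use cl in \<open>auto simp: cl_def intro!: continuous_intros\<close>)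
    then have "continuous_on UNIV (Q (apply_bcontfun u))"
      unfolding Q_def by (intro continuous_intros)
    moreover have "norm (Q (apply_bcontfun u) t) \<le> norm y0 + e * M" for t
      unfolding Q_def using norm_triangle_ineq int_bound[of t u]
      by (meson add_left_mono order_trans)
    ultimately show ?thesis
      unfolding bcontfun_def by (auto simp: bounded_iff)
  qed
  define P where "P = (\<lambda>u. Bcontfun (Q (apply_bcontfun u)))"
  have P_apply: "apply_bcontfun (P u) t = Q (apply_bcontfun u) t" for u t
    unfolding P_def using Q_bcont by (simp add: Bcontfun_inverse)
  have contr: "dist (P u) (P v) \<le> (1/2) * dist u v" for u v
  proof (rule dist_bound)
    fix t
    have "dist (P u t) (P v t)
        = norm (integral {s..cl t} (\<lambda>\<tau>. g (u \<tau>)) - integral {s..cl t} (\<lambda>\<tau>. g (v \<tau>)))"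
      by (simp add: P_apply Q_def dist_norm)
    also have "\<dots> = norm (integral {s..cl t} (\<lambda>\<tau>. g (u \<tau>) - g (v \<tau>)))"
      by (subst integral_diff) (intro integrable_continuous_real gu_cont refl)+
    also have "\<dots> \<le> (L * dist u v) * (cl t - s)"
    proof (rule integral_bound)
      show "s \<le> cl t" using cl by auto
      show "continuous_on {s..cl t} (\<lambda>\<tau>. g (u \<tau>) - g (v \<tau>))"
        by (intro continuous_intros gu_cont)
      show "norm (g (u \<tau>) - g (v \<tau>)) \<le> L * dist u v" for \<tau>
        using g_lip[of "u \<tau>" "v \<tau>"] mult_left_mono[OF dist_bounded[of u \<tau> v] \<open>L \<ge> 0\<close>]
        by (simp add: dist_norm)
    qed
    also have "\<dots> \<le> (L * dist u v) * e"
      using cl[of t] \<open>L \<ge> 0\<close> by (intro mult_left_mono) auto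
    also have "\<dots> = (e * L) * dist u v" by simp
    also have "\<dots> \<le> (1/2) * dist u v" by (intro mult_right_mono eL) auto
    finally show "dist (P u t) (P v t) \<le> (1/2) * dist u v" .
  qed
  obtain u where u: "P u = u"
    using banach_fix_type[of "1/2" P] contr by auto
  have u_eq: "u t = y0 + integral {s..cl t} (\<lambda>\<tau>. g (u \<tau>))" for t
    using P_apply[of u t] by (simp add: u Q_def)
  have gf: "g (u t) = f (u t)" for t
  proof -
    have "dist y0 (u t) \<le> r"
      using int_bound[of t u] eM by (subst u_eq) (simp add: dist_norm)
    then show ?thesis unfolding g_def by (simp add: closest_point_self)
  qed
  have "(u has_vector_derivative f (u t)) (at t within {s..s+e})" if t: "t \<in> {s..s+e}" for t
  proof -
    have "((\<lambda>t. y0 + integral {s..t} (\<lambda>\<tau>. g (u \<tau>))) has_vector_derivative (0 + g (u t)))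
        (at t within {s..s+e})"
      by (intro has_vector_derivative_add has_vector_derivative_const
          integral_has_vector_derivative gu_cont t)
    then have deriv: "((\<lambda>t. y0 + integral {s..t} (\<lambda>\<tau>. g (u \<tau>))) has_vector_derivative f (u t))
        (at t within {s..s+e})" by (simp add: gf)
    have "u t = y0 + integral {s..t} (\<lambda>\<tau>. g (u \<tau>))" if "t \<in> {s..s+e}" for t
      using that u_eq[of t] by (simp add: cl_def)
    then show ?thesis by (rule has_vector_derivative_transform[OF t _ deriv])
  qed
  moreover have "u s = y0" using \<open>e > 0\<close> by (subst u_eq) (simp add: cl_def)
  ultimately show ?thesis using that \<open>e > 0\<close> by blast
qed

lemma C1_lipschitz_on_cball:
  fixes f :: "'a::euclidean_space \<Rightarrow> 'b::real_normed_vector"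
  assumes "C_class 1 f"
  obtains L where "L-lipschitz_on (cball y r) f"
proof -
  let ?D = "\<lambda>x. frechet_derivative f (at x)"
  have diff: "(f has_derivative ?D x) (at x)" for x
    using assms by (simp add: frechet_derivative_works[symmetric])
  have cont: "continuous_on UNIV (\<lambda>x. ?D x v)" for v using assms by simp
  have "\<exists>B. \<forall>x\<in>cball y r. norm (?D x b) \<le> B" for b
  proof -
    have "compact ((\<lambda>x. ?D x b) ` cball y r)"
      by (intro compact_continuous_image continuous_on_subset[OF cont]) auto
    then show ?thesis by (meson bounded_iff compact_imp_bounded imageI)
  qed
  then obtain B where B: "\<And>b x. x \<in> cball y r \<Longrightarrow> norm (?D x b) \<le> B b" by metis
  define K where "K = (\<Sum>b\<in>Basis. \<bar>B b\<bar>)"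
  have "K \<ge> 0" unfolding K_def by (intro sum_nonneg) auto
  have "norm (?D x v) \<le> K * norm v" if x: "x \<in> cball y r" for x v
  proof -
    have lin: "linear (?D x)" using diff has_derivative_linear by blast
    have "?D x v = ?D x (\<Sum>b\<in>Basis. (v \<bullet> b) *\<^sub>R b)" by (simp add: euclidean_representation)
    also have "\<dots> = (\<Sum>b\<in>Basis. (v \<bullet> b) *\<^sub>R ?D x b)"
      by (simp add: linear_sum[OF lin] linear_cmul[OF lin])
    also have "norm \<dots> \<le> (\<Sum>b\<in>Basis. norm v * \<bar>B b\<bar>)"
    proof (rule sum_norm_le)
      fix b :: 'a assume "b \<in> Basis"
      then show "norm ((v \<bullet> b) *\<^sub>R ?D x b) \<le> norm v * \<bar>B b\<bar>"
        using B[OF x, of b] by (simp add: Basis_le_norm mult_mono)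
    qed
    finally show ?thesis by (simp add: K_def sum_distrib_left[symmetric] mult.commute)
  qed
  then have on: "onorm (?D x) \<le> K" if "x \<in> cball y r" for x using that by (intro onorm_le) auto
  have "K-lipschitz_on (cball y r) f"
    unfolding lipschitz_on_def
  proof (intro conjI ballI \<open>K \<ge> 0\<close>)
    fix x x' assume "x \<in> cball y r" "x' \<in> cball y r"
    then show "dist (f x) (f x') \<le> K * dist x x'"
      using differentiable_bound[of "cball y r" f ?D K x x'] on diff
      by (auto simp: dist_norm has_derivative_at_withinI)
  qed
  then show ?thesis using that by blast
qed

text \<open>On a compact set \<open>f\<close> is bounded, so the solution is Lipschitz and has a limit at \<open>T\<close>. That the
  extension is differentiable at \<open>T\<close>, with the right derivative, follows from the integral
  equation, whose right-hand side is differentiable on the closed interval.\<close>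

lemma solution_extends_to_endpoint:
  fixes x :: "real \<Rightarrow> real^'n"
  assumes f: "continuous_on UNIV f" and K: "compact K"
    and "T > 0" "solution_on f J x" "J \<inter> {0..} = {0..<T}"
    and xK: "\<And>t. t \<in> {0..<T} \<Longrightarrow> x t \<in> K"
  obtains y where "solution_on f (insert T J) y" "\<And>t. t \<in> J \<Longrightarrow> y t = x t"
proof -
  have J: "is_interval J" and deriv: "\<And>t. t \<in> J \<Longrightarrow> (x has_vector_derivative f (x t)) (at t within J)"
    using assms(4) by (auto simp: solution_on_def)
  have J_iff: "t \<in> J \<longleftrightarrow> t < T" if "t \<ge> 0" for t
    using that eqset_imp_iff[OF assms(5), of t] by simp
  have sub: "{0..<T} \<subseteq> J" and "0 \<in> J" and TJ: "T \<notin> J" using J_iff \<open>T > 0\<close> by auto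
  have Jlt: "t < T" if "t \<in> J" for t
    using that J_iff[of t] \<open>T > 0\<close> by (cases "t \<ge> 0") auto
  have "bounded (f ` K)"
    by (intro compact_imp_bounded compact_continuous_image continuous_on_subset[OF f] K) auto
  then obtain M where M: "\<And>y. y \<in> K \<Longrightarrow> norm (f y) \<le> M" by (auto simp: bounded_iff)
  have "\<bar>M\<bar>-lipschitz_on {0..<T} x"
    unfolding lipschitz_on_def
  proof (intro conjI ballI)
    fix a b assume ab: "a \<in> {0..<T}" "b \<in> {0..<T}"
    have "norm (x a - x b) \<le> \<bar>M\<bar> * norm (a - b)"
    proof (rule differentiable_bound[of "{0..<T}" x "\<lambda>t h. h *\<^sub>R f (x t)"])
      fix t assume t: "t \<in> {0..<T}"
      show "(x has_derivative (\<lambda>h. h *\<^sub>R f (x t))) (at t within {0..<T})"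
        using has_vector_derivative_within_subset[OF deriv sub] t sub
        by (auto simp: has_vector_derivative_def)
      show "onorm (\<lambda>h. h *\<^sub>R f (x t)) \<le> \<bar>M\<bar>"
        using M[OF xK[OF t]] by (intro onorm_le) (auto simp: mult.commute intro: mult_left_mono)
    qed (use ab in auto)
    then show "dist (x a) (x b) \<le> \<bar>M\<bar> * dist a b" by (simp add: dist_norm)
  qed auto
  then have "uniformly_continuous_on {0..<T} x" by (rule lipschitz_on_uniformly_continuous)
  then obtain g where "uniformly_continuous_on (closure {0..<T}) g"
    and gx: "\<And>t. t \<in> {0..<T} \<Longrightarrow> x t = g t"
    by (rule uniformly_continuous_on_extension_on_closure) simp
  then have g_cont: "continuous_on {0..T} g"
    using \<open>T > 0\<close> by (simp add: uniformly_continuous_imp_continuous)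
  have fg_cont: "continuous_on {0..T} (\<lambda>t. f (g t))"
    by (rule continuous_on_compose2[OF f g_cont]) auto
  define I where "I = (\<lambda>t. g 0 + integral {0..t} (\<lambda>\<tau>. f (g \<tau>)))"
  have I_deriv: "(I has_vector_derivative f (g t)) (at t within {0..T})" if "t \<in> {0..T}" for t
    unfolding I_def
    using has_vector_derivative_add[OF has_vector_derivative_const
        integral_has_vector_derivative[OF fg_cont that]]
    by simp
  have I_cont: "continuous_on {0..T} I"
    using I_deriv by (meson continuous_on_eq_continuous_within has_vector_derivative_continuous)
  have Ig: "I t = g t" if t: "t \<in> {0..<T}" for t
  proof -
    have "((\<lambda>\<tau>. f (x \<tau>)) has_integral (x t - x 0)) {0..t}"
    proof (rule fundamental_theorem_of_calculus)
      fix \<tau> assume "\<tau> \<in> {0..t}"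
      moreover have "{0..t} \<subseteq> J" using t sub by auto
      ultimately show "(x has_vector_derivative f (x \<tau>)) (at \<tau> within {0..t})"
        using has_vector_derivative_within_subset[OF deriv] by blast
    qed (use t in auto)
    then have "((\<lambda>\<tau>. f (g \<tau>)) has_integral (x t - x 0)) {0..t}"
      by (rule has_integral_eq[rotated]) (use t gx in auto)
    then show ?thesis using gx[of 0] gx[OF t] t by (simp add: I_def integral_unique)
  qed
  have IgT: "I t = g t" if "t \<in> {0..T}" for t
  proof -
    have "closed {t \<in> {0..T}. I t - g t = 0}"
      by (intro continuous_closed_preimage_constant continuous_intros I_cont g_cont)
    moreover have "{0..<T} \<subseteq> {t \<in> {0..T}. I t - g t = 0}" using Ig by auto
    ultimately have "closure {0..<T} \<subseteq> {t \<in> {0..T}. I t - g t = 0}" by (rule closure_minimal[rotated])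
    then show ?thesis using that \<open>T > 0\<close> by auto
  qed
  define y where "y = x(T := g T)"
  have yx: "y t = x t" if "t \<in> J" for t using that TJ by (auto simp: y_def)
  have yI: "y t = I t" if "t \<in> {0..T}" for t
    using that gx[of t] IgT[OF that] by (cases "t = T") (auto simp: y_def)
  have "solution_on f (insert T J) y"
    unfolding solution_on_def
  proof (intro conjI ballI)
    show "is_interval (insert T J)"
      unfolding is_interval_1
    proof (intro ballI allI impI)
      fix a b t assume ab: "a \<in> insert T J" "b \<in> insert T J" "a \<le> t \<and> t \<le> b"
      show "t \<in> insert T J"
      proof (cases "t \<in> {0..T}")
        case True then show ?thesis using sub by force
      next
        case False
        then have "t < 0" using ab Jlt by fastforce
        then have "a \<in> J" using ab \<open>T > 0\<close> by auto
        then show ?thesis using J \<open>0 \<in> J\<close> ab \<open>t < 0\<close> unfolding is_interval_1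
          by (meson insertCI less_imp_le)
      qed
    qed
    show "0 \<in> insert T J" using \<open>0 \<in> J\<close> by simp
    fix t assume t: "t \<in> insert T J"
    show "(y has_vector_derivative f (y t)) (at t within insert T J)"
    proof (cases "t = T")
      case True
      have "(I has_vector_derivative f (y t)) (at t within {0..T})"
        using I_deriv[of t] yI[of t] IgT[of t] True \<open>T > 0\<close> by simp
      then have "(y has_vector_derivative f (y t)) (at t within {0..T})"
        by (rule has_vector_derivative_transform[OF _ yI, rotated 2]) (use True \<open>T > 0\<close> in auto)
      moreover have "at t within {0..T} = at t within insert T J"
      proof (rule at_within_nhd[of t "{0<..}"])
        show "{0..T} \<inter> {0<..} - {t} = insert T J \<inter> {0<..} - {t}"
          using True J_iff Jlt by force
      qed (use True \<open>T > 0\<close> in auto)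
      ultimately show ?thesis by simp
    next
      case False
      then have "t \<in> J" "t < T" using t Jlt by auto
      have "(y has_vector_derivative f (y t)) (at t within J)"
        unfolding yx[OF \<open>t \<in> J\<close>]
        by (rule has_vector_derivative_transform[OF \<open>t \<in> J\<close> yx deriv[OF \<open>t \<in> J\<close>]])
      moreover have "at t within J = at t within insert T J"
        by (rule at_within_nhd[of t "{..<T}"]) (use \<open>t < T\<close> in auto)
      ultimately show ?thesis by simp
    qed
  qed
  then show ?thesis using that yx by blast
qed

text \<open>Picard's local solution with initial value \<open>x T\<close> at time \<open>T\<close> is glued to \<open>x\<close>.\<close>

lemma solution_extends_past_endpoint:
  fixes x :: "real \<Rightarrow> real^'n"
  assumes "C_class 1 f" and sol: "solution_on f J x" and "T \<in> J" and le: "\<And>t. t \<in> J \<Longrightarrow> t \<le> T"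
  obtains e y where "e > 0" "solution_on f (J \<union> {T..T+e}) y" "\<And>t. t \<in> J \<Longrightarrow> y t = x t"
proof -
  obtain L where "L-lipschitz_on (cball (x T) 1) f" using C1_lipschitz_on_cball[OF assms(1)] .
  then obtain e z where "e > 0" and zT: "z T = x T"
    and z: "\<And>t. t \<in> {T..T+e} \<Longrightarrow> (z has_vector_derivative f (z t)) (at t within {T..T+e})"
    using picard_existence[of 1 L "x T" f T] by auto
  define y where "y = (\<lambda>t. if t \<in> J then x t else z t)"
  have J: "is_interval J" "0 \<in> J"
    and deriv: "\<And>t. t \<in> J \<Longrightarrow> (x has_vector_derivative f (x t)) (at t within J)"
    using sol by (auto simp: solution_on_def)
  have clJ: "t \<le> T" if "t \<in> closure J" for t
    using that closure_minimal[of J "{..T}"] le by auto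
  have inter: "closure J \<inter> closure {T..T+e} = {T}"
    using clJ \<open>T \<in> J\<close> \<open>e > 0\<close> closure_subset[of J] by force
  have "solution_on f (J \<union> {T..T+e}) y"
    unfolding solution_on_def
  proof (intro conjI ballI)
    show "is_interval (J \<union> {T..T+e})"
      using J(1) \<open>T \<in> J\<close> \<open>e > 0\<close>
      by (auto simp: is_interval_connected_1 intro!: connected_Un)
    show "0 \<in> J \<union> {T..T+e}" using J by simp
    fix t assume t: "t \<in> J \<union> {T..T+e}"
    have "((\<lambda>t. if t \<in> J then x t else z t) has_vector_derivative
        (if t \<in> J then f (x t) else f (z t))) (at t within J \<union> {T..T+e})"
    proof (rule has_vector_derivative_If_within_closures[OF t refl])
      have eq: "J \<union> closure J \<inter> closure {T..T+e} = J" "{T..T+e} \<union> closure J \<inter> closure {T..T+e} = {T..T+e}"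
        using inter \<open>T \<in> J\<close> \<open>e > 0\<close> by auto
      show "(x has_vector_derivative f (x t)) (at t within J \<union> closure J \<inter> closure {T..T+e})"
        if "t \<in> J \<union> closure J \<inter> closure {T..T+e}" using that deriv unfolding eq by auto
      show "(z has_vector_derivative f (z t)) (at t within {T..T+e} \<union> closure J \<inter> closure {T..T+e})"
        if "t \<in> {T..T+e} \<union> closure J \<inter> closure {T..T+e}" using that z unfolding eq by auto
      assume "t \<in> closure J" "t \<in> closure {T..T+e}"
      then have "t = T" using inter by blast
      then show "x t = z t" "f (x t) = f (z t)" using zT by simp_all
    qed
    then show "(y has_vector_derivative f (y t)) (at t within J \<union> {T..T+e})"
      unfolding y_def by (simp add: if_distrib[of f] cong: if_cong)
  qed
  then show ?thesis using that[of e y] \<open>e > 0\<close> by (simp add: y_def)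
qed

text \<open>The escape lemma: a maximal solution can end only by leaving every compact set. If its time domain
  were bounded above, it would contain its supremum by the first extension lemma, and the second one
  would then contradict maximality.\<close>

lemma bounded_trajectory_global:
  fixes x :: "real \<Rightarrow> real^'n"
  assumes C1: "C_class 1 f" and traj: "trajectory f J x" and "compact K"
    and xK: "\<And>t. t \<in> J \<Longrightarrow> t \<ge> 0 \<Longrightarrow> x t \<in> K"
  shows "{0..} \<subseteq> J"
proof (rule ccontr)
  have sol: "solution_on f J x"
    and maximal: "\<And>J' y. solution_on f J' y \<Longrightarrow> J \<subseteq> J' \<Longrightarrow> (\<And>t. t \<in> J \<Longrightarrow> y t = x t) \<Longrightarrow> J' = J"
    using traj unfolding trajectory_def by (blast, meson)
  have J: "is_interval J" "0 \<in> J" using sol by (auto simp: solution_on_def)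
  assume "\<not> {0..} \<subseteq> J"
  then obtain b where "b \<ge> 0" "b \<notin> J" by auto
  have ltb: "t < b" if "t \<in> J" for t
    using J that \<open>b \<ge> 0\<close> \<open>b \<notin> J\<close> unfolding is_interval_1 by (meson not_less)
  then have bdd: "bdd_above J" by (meson bdd_above.I less_imp_le)
  define T where "T = Sup J"
  have le: "t \<le> T" if "t \<in> J" for t unfolding T_def using that bdd by (rule cSup_upper)
  show False
  proof (cases "T \<in> J")
    case True
    then obtain e y where "e > 0" "solution_on f (J \<union> {T..T+e}) y" "\<And>t. t \<in> J \<Longrightarrow> y t = x t"
      using solution_extends_past_endpoint[OF C1 sol] le by metis
    then have "J \<union> {T..T+e} = J" using maximal by blast
    moreover have "T + e \<in> J \<union> {T..T+e}" using \<open>e > 0\<close> by simp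
    ultimately have "T + e \<in> J" by (simp only:)
    then show False using le \<open>e > 0\<close> by fastforce
  next
    case False
    then have "T > 0" using le[OF J(2)] J(2) by (cases "T = 0") auto
    have eq: "J \<inter> {0..} = {0..<T}"
    proof
      show "J \<inter> {0..} \<subseteq> {0..<T}" using le False by (auto simp: order_less_le)
      show "{0..<T} \<subseteq> J \<inter> {0..}"
      proof
        fix t assume t: "t \<in> {0..<T}"
        have "J \<noteq> {}" using J(2) by blast
        then obtain u where u: "u \<in> J" "t < u"
          using less_cSup_iff[OF _ bdd] t unfolding T_def by (meson atLeastLessThan_iff)
        have "t \<in> J" by (rule mem_is_interval_1_I[OF J(1) J(2) u(1)]) (use t u in auto)
        then show "t \<in> J \<inter> {0..}" using t by simp
      qed
    qed
    have f_cont: "continuous_on UNIV f"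
      using C1 by (simp add: differentiable_imp_continuous_within continuous_on_eq_continuous_within)
    have "\<And>t. t \<in> {0..<T} \<Longrightarrow> x t \<in> K" using xK eq by blast
    then obtain y where "solution_on f (insert T J) y" "\<And>t. t \<in> J \<Longrightarrow> y t = x t"
      using solution_extends_to_endpoint[OF f_cont \<open>compact K\<close> \<open>T > 0\<close> sol eq] by metis
    then have "insert T J = J" using maximal by blast
    then show False using False by blast
  qed
qed

section \<open>Conserved functions with a strict minimum\<close>

text \<open>The second derivative test for a gradient that is differentiable at the one point \<open>x\<close>. Near \<open>x\<close>
  the function \<open>V\<close> increases strictly along each ray from \<open>x\<close>, since the
  derivative at \<open>x + t *\<^sub>R h\<close> in direction \<open>h\<close> is \<open>t * (P h \<bullet> h)\<close> up to an error that is small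
  compared with \<open>t * (norm h)\<^sup>2\<close>.\<close>

lemma strict_local_minimum:
  fixes V :: "'a::euclidean_space \<Rightarrow> real"
  assumes grad: "\<And>y. GDERIV V y :> p y" and "p x = 0" and P: "(p has_derivative P) (at x)"
    and pos: "\<And>v. v \<noteq> 0 \<Longrightarrow> P v \<bullet> v > 0"
  obtains r where "r > 0" "\<And>y. y \<noteq> x \<Longrightarrow> dist y x < r \<Longrightarrow> V x < V y"
proof -
  have lin: "linear P" and bl: "bounded_linear P"
    using P has_derivative_linear has_derivative_bounded_linear by auto
  have "continuous_on UNIV (\<lambda>v. P v \<bullet> v)"
    by (intro continuous_intros linear_continuous_on[OF bl])
  obtain m where "m > 0" and m: "\<And>v. P v \<bullet> v \<ge> m * (norm v)\<^sup>2"
  proof -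
    have ne: "sphere (0::'a) 1 \<noteq> {}" by simp
    obtain a where a: "norm a = 1" "\<And>v. norm v = 1 \<Longrightarrow> P a \<bullet> a \<le> P v \<bullet> v"
      using continuous_attains_inf[OF compact_sphere ne
          continuous_on_subset[OF \<open>continuous_on UNIV (\<lambda>v. P v \<bullet> v)\<close>]] by auto
    have "P v \<bullet> v \<ge> (P a \<bullet> a) * (norm v)\<^sup>2" for v
    proof (cases "v = 0")
      case True then show ?thesis by simp
    next
      case False
      define u where "u = v /\<^sub>R norm v"
      have v: "v = norm v *\<^sub>R u" and "norm u = 1" using False by (simp_all add: u_def)
      have "P v \<bullet> v = (P u \<bullet> u) * (norm v)\<^sup>2"
        by (subst (1 2) v) (simp add: linear_cmul[OF lin] power2_eq_square)
      then show ?thesis using a(2)[OF \<open>norm u = 1\<close>] by (simp add: mult_right_mono)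
    qed
    moreover have "P a \<bullet> a > 0" using pos[of a] a(1) by force
    ultimately show ?thesis using that by blast
  qed
  obtain r where "r > 0"
    and r: "\<And>y. norm (y - x) < r \<Longrightarrow> norm (p y - p x - P (y - x)) \<le> (m/2) * norm (y - x)"
    using P \<open>m > 0\<close> unfolding has_derivative_at_alt by (meson half_gt_zero)
  have V_cont: "continuous_on UNIV V"
    using grad unfolding gderiv_def by (rule has_derivative_continuous_on[OF has_derivative_at_withinI])
  have "V x < V y" if y: "y \<noteq> x" "dist y x < r" for y
  proof -
    define h where "h = y - x"
    have "h \<noteq> 0" "norm h < r" using y by (auto simp: h_def dist_norm)
    have "V (x + 0 *\<^sub>R h) < V (x + 1 *\<^sub>R h)"
    proof (rule DERIV_pos_imp_increasing_open[of 0 1 "\<lambda>t. V (x + t *\<^sub>R h)"])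
      have D: "DERIV (\<lambda>t. V (x + t *\<^sub>R h)) t :> h \<bullet> p (x + t *\<^sub>R h)" for t :: real
      proof -
        have "((\<lambda>t. x + t *\<^sub>R h) has_derivative (\<lambda>s. s *\<^sub>R h)) (at t)"
          by (auto intro!: derivative_eq_intros)
        from has_derivative_compose[OF this grad[unfolded gderiv_def]]
        show ?thesis by (rule has_derivative_imp_has_field_derivative) simp
      qed
      fix t :: real assume t: "0 < t" "t < 1"
      have "norm (t *\<^sub>R h) < r"
        using t \<open>norm h < r\<close> mult_right_mono[of t 1 "norm h"] by simp
      then have "norm (p (x + t *\<^sub>R h) - t *\<^sub>R P h) \<le> (m/2) * (t * norm h)"
        using r[of "x + t *\<^sub>R h"] t \<open>p x = 0\<close> by (simp add: linear_cmul[OF lin])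
      then have "\<bar>h \<bullet> (p (x + t *\<^sub>R h) - t *\<^sub>R P h)\<bar> \<le> norm h * ((m/2) * (t * norm h))"
        by (meson Cauchy_Schwarz_ineq2 mult_left_mono norm_ge_zero order_trans)
      then have "h \<bullet> p (x + t *\<^sub>R h) \<ge> t * (P h \<bullet> h) - (m/2) * t * (norm h)\<^sup>2"
        unfolding abs_le_iff by (simp add: inner_diff_right inner_commute[of h] power2_eq_square algebra_simps)
      moreover have "t * (P h \<bullet> h) \<ge> t * (m * (norm h)\<^sup>2)" using m[of h] t by simp
      moreover have "m * t * (norm h)\<^sup>2 > 0" using \<open>m > 0\<close> t \<open>h \<noteq> 0\<close> by simp
      ultimately have "h \<bullet> p (x + t *\<^sub>R h) > 0" by (simp add: algebra_simps)
      then show "\<exists>y. DERIV (\<lambda>t. V (x + t *\<^sub>R h)) t :> y \<and> y > 0" using D by blast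
    next
      show "continuous_on {0..1} (\<lambda>t. V (x + t *\<^sub>R h))"
        by (intro continuous_on_compose2[OF V_cont] continuous_intros) simp
    qed simp
    then show ?thesis by (simp add: h_def)
  qed
  then show ?thesis using that \<open>r > 0\<close> by blast
qed

text \<open>Since \<open>V\<close> is constant along solutions, a solution that starts inside a small sphere at a level
  below the minimum of \<open>V\<close> on that sphere can never meet it.\<close>

lemma lyapunov_stability:
  fixes f :: "real^'n \<Rightarrow> real^'n"
  assumes f: "C_class 1 f" "f xe = 0"
    and grad: "\<And>y. GDERIV V y :> p y" and orth: "\<And>y. f y \<bullet> p y = 0"
    and "r > 0" and minimum: "\<And>y. y \<noteq> xe \<Longrightarrow> dist y xe < r \<Longrightarrow> V xe < V y"
  shows "nonlinearly_stable_equilibrium f xe"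
  unfolding nonlinearly_stable_equilibrium_def
proof (intro conjI allI impI \<open>f xe = 0\<close>)
  fix U assume "xe \<in> interior U"
  have V_cont: "continuous_on A V" for A
    using grad unfolding gderiv_def by (meson has_derivative_continuous_on has_derivative_at_withinI)
  obtain e where "e > 0" and e: "cball xe e \<subseteq> U"
    using \<open>xe \<in> interior U\<close> by (meson mem_interior_cball)
  define \<rho> where "\<rho> = min e (r/2)"
  have "\<rho> > 0" "\<rho> < r" "\<rho> \<le> e" using \<open>e > 0\<close> \<open>r > 0\<close> by (auto simp: \<rho>_def)
  have "sphere xe \<rho> \<noteq> {}" using \<open>\<rho> > 0\<close> by simp
  then obtain z where z: "z \<in> sphere xe \<rho>" "\<And>y. y \<in> sphere xe \<rho> \<Longrightarrow> V z \<le> V y"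
    using continuous_attains_inf[OF compact_sphere _ V_cont] by metis
  have "V xe < V z"
    using z(1) \<open>\<rho> > 0\<close> \<open>\<rho> < r\<close> by (intro minimum) (auto simp: dist_commute)
  define U' where "U' = ball xe \<rho> \<inter> {y. V y < V z}"
  have "open U'"
    unfolding U'_def by (intro open_Int open_ball open_Collect_less V_cont continuous_on_const)
  show "\<exists>U'\<subseteq>U. xe \<in> interior U' \<and>
      (\<forall>J x. trajectory f J x \<and> x 0 \<in> U' \<longrightarrow> {0..} \<subseteq> J \<and> (\<forall>t\<ge>0. x t \<in> U))"
  proof (intro exI[of _ U'] conjI allI impI)
    show "U' \<subseteq> U" using e \<open>\<rho> \<le> e\<close> by (auto simp: U'_def)
    show "xe \<in> interior U'"
      unfolding interior_open[OF \<open>open U'\<close>]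
      using \<open>V xe < V z\<close> \<open>\<rho> > 0\<close> by (simp add: U'_def)
    fix J x assume "trajectory f J x \<and> x 0 \<in> U'"
    then have traj: "trajectory f J x" and x0: "x 0 \<in> U'" by auto
    have J: "is_interval J" "0 \<in> J"
      and x': "\<And>t. t \<in> J \<Longrightarrow> (x has_vector_derivative f (x t)) (at t within J)"
      using traj by (auto simp: trajectory_def solution_on_def)
    have x_cont: "continuous_on J x"
      using x' by (meson continuous_on_eq_continuous_within has_vector_derivative_continuous)
    have "((\<lambda>t. V (x t)) has_derivative (\<lambda>h. 0)) (at t within J)" if "t \<in> J" for t
    proof -
      have "((\<lambda>t. V (x t)) has_derivative (\<lambda>h. (h *\<^sub>R f (x t)) \<bullet> p (x t))) (at t within J)"
        using has_derivative_compose[OF x'[OF that, unfolded has_vector_derivative_def]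
            grad[unfolded gderiv_def]] .
      then show ?thesis by (simp add: orth)
    qed
    then have "\<exists>c. \<forall>t\<in>J. V (x t) = c"
      using has_derivative_zero_constant is_interval_convex J(1) by blast
    then have V_const: "V (x t) = V (x 0)" if "t \<in> J" for t using that J(2) by metis
    have ball: "x t \<in> cball xe \<rho>" if t: "t \<in> J" for t
    proof (rule ccontr)
      assume "x t \<notin> cball xe \<rho>"
      then have "x ` J \<inter> (- ball xe \<rho>) \<noteq> {}" and "x ` J \<inter> ball xe \<rho> \<noteq> {}"
        using t J(2) x0 by (auto simp: U'_def)
      moreover have "connected (x ` J)"
        using connected_continuous_image[OF x_cont] J(1) is_interval_connected by blast
      ultimately have "x ` J \<inter> frontier (ball xe \<rho>) \<noteq> {}"
        using connected_Int_frontier by blast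
      then obtain u where u: "u \<in> J" "x u \<in> sphere xe \<rho>"
        unfolding frontier_ball[OF \<open>\<rho> > 0\<close>] by blast
      then have "V z \<le> V (x 0)" using z(2)[OF u(2)] V_const[OF u(1)] by simp
      then show False using x0 by (simp add: U'_def)
    qed
    show "{0..} \<subseteq> J"
      using bounded_trajectory_global[OF f(1) traj compact_cball] ball by blast
    then show "x t \<in> U" if "t \<ge> 0" for t
      using ball[of t] that e \<open>\<rho> \<le> e\<close> by force
  qed
qed

section \<open>Gradients and Hessians\<close>

lemma GDERIV_frechet:
  assumes "GDERIV F x :> g"
  shows "frechet_derivative F (at x) v = v \<bullet> g"
  using fun_cong[OF frechet_derivative_at[OF assms[unfolded gderiv_def]]] by simp

lemma GDERIV_unique:
  assumes "GDERIV F x :> g" "GDERIV F x :> g'"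
  shows "g = g'"
proof -
  have "(\<lambda>h. h \<bullet> g) = (\<lambda>h. h \<bullet> g')"
    using assms unfolding gderiv_def by (rule has_derivative_unique)
  from fun_cong[OF this, of "g - g'"] have "(g - g') \<bullet> (g - g') = 0"
    by (simp add: inner_diff_right)
  then show ?thesis by simp
qed

text \<open>This replaces the matrix of iterated partial derivatives by the derivative of the gradient map, for
  which the chain and product rules are available.\<close>

lemma hessian_quadratic_form:
  fixes F :: "real^'n \<Rightarrow> real"
  assumes grad: "\<And>y. GDERIV F y :> p y" and P: "(p has_derivative P) (at x)"
  shows "v \<bullet> (hessian F x *v w) = P v \<bullet> w"
proof -
  have part: "partial b F = (\<lambda>y. p y $ b)" for b
  proof
    fix y
    have "(\<lambda>h. h \<bullet> p y) = frechet_derivative F (at y)"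
      using grad[of y] unfolding gderiv_def by (rule frechet_derivative_at)
    then show "partial b F y = p y $ b"
      unfolding partial_def by (metis inner_axis' inner_real_def mult_1)
  qed
  have "partial a (partial b F) x = P (axis a 1) $ b" for a b
  proof -
    have "((\<lambda>y. p y $ b) has_derivative (\<lambda>h. P h $ b)) (at x)"
      using P by (rule bounded_linear.has_derivative[OF bounded_linear_vec_nth])
    from frechet_derivative_at[OF this] show ?thesis
      unfolding part unfolding partial_def by metis
  qed
  then have H: "hessian F x $ a $ b = P (axis a 1) $ b" for a b by (simp add: hessian_def)
  have lin: "linear P" using P has_derivative_linear by blast
  have "P v = P (\<Sum>a\<in>UNIV. v $ a *\<^sub>R axis a 1)"
    by (simp add: basis_expansion scalar_mult_eq_scaleR[symmetric])
  also have "\<dots> = (\<Sum>a\<in>UNIV. v $ a *\<^sub>R P (axis a 1))"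
    by (simp add: linear_sum[OF lin] linear_cmul[OF lin])
  finally have "P v = v v* hessian F x"
    by (simp add: vec_eq_iff vector_matrix_mult_def H mult.commute)
  then show ?thesis by (simp add: dot_lmul_matrix)
qed

lemma C2_gradient:
  fixes F :: "'a::euclidean_space \<Rightarrow> real"
  assumes "C_class 2 F"
  obtains p P where "\<And>y. GDERIV F y :> p y" "\<And>y. (p has_derivative P y) (at y)"
proof -
  let ?D = "\<lambda>y. frechet_derivative F (at y)"
  have diff: "(F has_derivative ?D y) (at y)" for y
    using assms by (simp add: numeral_2_eq_2 frechet_derivative_works[symmetric])
  have diff2: "(\<lambda>y. ?D y v) differentiable (at y)" for v y
    using assms by (simp add: numeral_2_eq_2)
  define p where "p = (\<lambda>y. \<Sum>b\<in>Basis. ?D y b *\<^sub>R b)"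
  have "?D y h = h \<bullet> p y" for y h
  proof -
    have lin: "linear (?D y)" using diff has_derivative_linear by blast
    have "?D y h = ?D y (\<Sum>b\<in>Basis. (h \<bullet> b) *\<^sub>R b)" by (simp add: euclidean_representation)
    also have "\<dots> = (\<Sum>b\<in>Basis. (h \<bullet> b) *\<^sub>R ?D y b)"
      by (simp add: linear_sum[OF lin] linear_cmul[OF lin])
    also have "\<dots> = h \<bullet> p y" by (simp add: p_def inner_sum_right mult.commute)
    finally show ?thesis .
  qed
  then have "?D y = (\<lambda>h. h \<bullet> p y)" for y by blast
  then have grad: "GDERIV F y :> p y" for y
    unfolding gderiv_def using diff[of y] by simp
  have p_diff: "p differentiable (at y)" for y
    unfolding p_def by (intro differentiable_sum differentiable_scaleR differentiable_const diff2 ballI) auto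
  then have "(p has_derivative frechet_derivative p (at y)) (at y)" for y
    using frechet_derivative_works by blast
  with grad show ?thesis by (rule that)
qed

lemma C2_real_derivatives:
  fixes \<phi> :: "real \<Rightarrow> real"
  assumes "C_class 2 \<phi>"
  obtains \<phi>1 \<phi>2 where "\<And>s. DERIV \<phi> s :> \<phi>1 s" "\<And>s. DERIV \<phi>1 s :> \<phi>2 s"
proof -
  have "DERIV \<phi> s :> frechet_derivative \<phi> (at s) 1" for s
  proof -
    have "\<phi> differentiable (at s)" using assms by (simp add: numeral_2_eq_2)
    then obtain c where c: "DERIV \<phi> s :> c" by (auto simp: real_differentiable_def)
    then have "frechet_derivative \<phi> (at s) = (*) c"
      unfolding has_field_derivative_def by (rule frechet_derivative_at[symmetric])
    then show ?thesis using c by simp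
  qed
  moreover have "\<exists>c. DERIV (\<lambda>s. frechet_derivative \<phi> (at s) 1) s :> c" for s
    using assms by (simp add: numeral_2_eq_2 real_differentiable_def[symmetric])
  ultimately show ?thesis using that by metis
qed

lemma C2_realI:
  fixes \<phi> :: "real \<Rightarrow> real"
  assumes "\<And>s. DERIV \<phi> s :> \<phi>1 s" "\<And>s. DERIV \<phi>1 s :> \<phi>2 s" "continuous_on UNIV \<phi>2"
  shows "C_class 2 \<phi>"
proof -
  have fr: "frechet_derivative \<psi> (at s) v = \<psi>1 s * v" if "\<And>s. DERIV \<psi> s :> \<psi>1 s"
    for \<psi> \<psi>1 :: "real \<Rightarrow> real" and s v
    using frechet_derivative_at[OF that[unfolded has_field_derivative_def]] by metis
  have fr2: "frechet_derivative (\<lambda>s. \<phi>1 s * v) (at s) w = \<phi>2 s * v * w" for s v w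
    using DERIV_cmult_right[OF assms(2)] by (intro fr)
  have "(\<lambda>s. \<phi>1 s * v) differentiable (at s)" for s v
    using DERIV_cmult_right[OF assms(2)] real_differentiable_def by blast
  moreover have "continuous_on UNIV (\<lambda>s. \<phi>2 s * v * w)" for v w
    using assms(3) by (intro continuous_intros)
  ultimately show ?thesis
    using assms(1) by (simp add: numeral_2_eq_2 fr[OF assms(1)] fr2) (metis real_differentiable_def)
qed

lemma composite_gradient:
  fixes C :: "'j \<Rightarrow> real^'n \<Rightarrow> real"
  assumes "finite A"
    and "\<And>y. GDERIV C0 y :> p0 y"
    and "\<And>j y. j \<in> A \<Longrightarrow> GDERIV (C j) y :> p j y"
    and "\<And>j s. j \<in> A \<Longrightarrow> DERIV (\<phi> j) s :> \<phi>1 j s"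
  shows "GDERIV (\<lambda>x. C0 x + (\<Sum>j\<in>A. (\<phi> j \<circ> C j) x)) y
           :> p0 y + (\<Sum>j\<in>A. \<phi>1 j (C j y) *\<^sub>R p j y)"
proof (rule GDERIV_add[OF assms(2)])
  have "GDERIV (\<lambda>x. (\<phi> j \<circ> C j) x) y :> \<phi>1 j (C j y) *\<^sub>R p j y" if "j \<in> A" for j
    unfolding o_def using that by (intro GDERIV_DERIV_compose assms)
  then show "GDERIV (\<lambda>x. \<Sum>j\<in>A. (\<phi> j \<circ> C j) x) y :> (\<Sum>j\<in>A. \<phi>1 j (C j y) *\<^sub>R p j y)"
    unfolding gderiv_def inner_sum_right by (rule has_derivative_sum)
qed

lemma composite_gradient_derivative:
  fixes C :: "'j \<Rightarrow> real^'n \<Rightarrow> real"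
  assumes "(p0 has_derivative P0) (at x)"
    and "\<And>j. j \<in> A \<Longrightarrow> GDERIV (C j) x :> p j x"
    and "\<And>j. j \<in> A \<Longrightarrow> (p j has_derivative P j) (at x)"
    and "\<And>j s. j \<in> A \<Longrightarrow> DERIV (\<phi>1 j) s :> \<phi>2 j s"
  shows "((\<lambda>y. p0 y + (\<Sum>j\<in>A. \<phi>1 j (C j y) *\<^sub>R p j y)) has_derivative
     (\<lambda>v. P0 v + (\<Sum>j\<in>A. \<phi>1 j (C j x) *\<^sub>R P j v + (\<phi>2 j (C j x) * (v \<bullet> p j x)) *\<^sub>R p j x))) (at x)"
proof (intro has_derivative_add has_derivative_sum assms(1))
  fix j assume j: "j \<in> A"
  have "((\<lambda>y. \<phi>1 j (C j y)) has_derivative (\<lambda>v. \<phi>2 j (C j x) * (v \<bullet> p j x))) (at x)"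
    using GDERIV_DERIV_compose[OF assms(2)[OF j] assms(4)[OF j]] by (simp add: gderiv_def)
  from has_derivative_scaleR[OF this assms(3)[OF j]]
  show "((\<lambda>y. \<phi>1 j (C j y) *\<^sub>R p j y) has_derivative
     (\<lambda>v. \<phi>1 j (C j x) *\<^sub>R P j v + (\<phi>2 j (C j x) * (v \<bullet> p j x)) *\<^sub>R p j x)) (at x)" .
qed

section \<open>Definite quadratic forms\<close>

text \<open>Finsler's lemma, by compactness of the unit sphere: on the part of the sphere with \<open>q \<le> 0\<close> the
  form \<open>s\<close> is bounded below by a positive number, and elsewhere there is nothing to do.\<close>

lemma finsler:
  fixes q s :: "'a::euclidean_space \<Rightarrow> real"
  assumes cont: "continuous_on UNIV q" "continuous_on UNIV s"
    and q_hom: "\<And>c v. q (c *\<^sub>R v) = c\<^sup>2 * q v" and s_hom: "\<And>c v. s (c *\<^sub>R v) = c\<^sup>2 * s v"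
    and s_nonneg: "\<And>v. s v \<ge> 0"
    and pos: "\<And>v. v \<noteq> 0 \<Longrightarrow> s v = 0 \<Longrightarrow> q v > 0"
  shows "\<exists>\<mu>. \<forall>v. v \<noteq> 0 \<longrightarrow> q v + \<mu> * s v > 0"
proof -
  define K where "K = sphere 0 1 \<inter> {v. q v \<le> 0}"
  have "closed {v. q v \<le> 0}" using cont by (intro closed_Collect_le) auto
  then have "compact K" unfolding K_def by (intro compact_Int_closed) auto
  have s_pos: "s v > 0" if "v \<in> K" for v
    using that pos[of v] s_nonneg[of v] by (fastforce simp: K_def order_less_le)
  have "\<exists>\<mu>\<ge>0. \<forall>v\<in>K. q v + \<mu> * s v > 0"
  proof (cases "K = {}")
    case False
    obtain a where a: "a \<in> K" "\<And>v. v \<in> K \<Longrightarrow> s a \<le> s v"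
      using continuous_attains_inf[OF \<open>compact K\<close> False, of s] continuous_on_subset[OF cont(2)] by blast
    obtain b where b: "b \<in> K" "\<And>v. v \<in> K \<Longrightarrow> q b \<le> q v"
      using continuous_attains_inf[OF \<open>compact K\<close> False, of q] continuous_on_subset[OF cont(1)] by blast
    have qb: "q b \<le> 0" using b by (simp add: K_def)
    show ?thesis
    proof (intro exI[of _ "(1 - q b) / s a"] conjI ballI)
      show "0 \<le> (1 - q b) / s a" using qb s_pos[OF a(1)] by simp
      fix v assume v: "v \<in> K"
      have "1 - q b = ((1 - q b) / s a) * s a" using s_pos[OF a(1)] by simp
      also have "\<dots> \<le> ((1 - q b) / s a) * s v"
        using a(2)[OF v] qb s_pos[OF a(1)] by (intro mult_left_mono) auto
      finally show "0 < q v + (1 - q b) / s a * s v" using b(2)[OF v] by linarith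
    qed
  qed auto
  then obtain \<mu> where "\<mu> \<ge> 0" and \<mu>: "\<And>v. v \<in> K \<Longrightarrow> q v + \<mu> * s v > 0" by blast
  have sphere: "q v + \<mu> * s v > 0" if "norm v = 1" for v
  proof (cases "v \<in> K")
    case False
    then have "q v > 0" using that by (auto simp: K_def)
    then show ?thesis using \<open>\<mu> \<ge> 0\<close> s_nonneg by (simp add: add_pos_nonneg)
  qed (use \<mu> in auto)
  have "q v + \<mu> * s v > 0" if "v \<noteq> 0" for v
  proof -
    define u where "u = v /\<^sub>R norm v"
    have v: "v = norm v *\<^sub>R u" using that by (simp add: u_def)
    have "norm u = 1" using that by (simp add: u_def)
    have "q v + \<mu> * s v = (norm v)\<^sup>2 * (q u + \<mu> * s u)"
      by (subst (1 2) v, subst q_hom, subst s_hom) (simp add: algebra_simps)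
    then show ?thesis using sphere[OF \<open>norm u = 1\<close>] that by simp
  qed
  then show ?thesis by blast
qed

text \<open>Positive or negative definiteness with the sign \<open>\<sigma>\<close> (\<open>1\<close> or \<open>-1\<close>) as a datum, so that both cases
  are treated at once.\<close>

definition definite_on :: "'a set \<Rightarrow> ('a::zero \<Rightarrow> real) \<Rightarrow> bool" where
  "definite_on W q \<longleftrightarrow> (\<exists>\<sigma>. \<sigma> * \<sigma> = 1 \<and> (\<forall>v\<in>W. v \<noteq> 0 \<longrightarrow> \<sigma> * q v > 0))"

lemma definite_on_hessian_iff:
  "pos_def_on W H \<or> neg_def_on W H \<longleftrightarrow> definite_on W (\<lambda>v. v \<bullet> (H *v v))"
proof -
  have "\<sigma> * \<sigma> = 1 \<longleftrightarrow> \<sigma> = 1 \<or> \<sigma> = -1" for \<sigma> :: real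
    using square_eq_1_iff by auto
  then show ?thesis
    unfolding definite_on_def pos_def_on_def neg_def_on_def by auto
qed

lemma definite_on_mono: "definite_on W q \<Longrightarrow> W' \<subseteq> W \<Longrightarrow> definite_on W' q"
  unfolding definite_on_def by blast

lemma definite_on_cong: "(\<And>v. v \<in> W \<Longrightarrow> q v = q' v) \<Longrightarrow> definite_on W q \<longleftrightarrow> definite_on W q'"
  unfolding definite_on_def by auto

section \<open>Combinations of constants of motion\<close>

text \<open>With gradients and Hessians given as data, the conditions (a), (b) and (c) become statements of
  linear algebra about the vectors \<open>p j xe\<close> and the linear maps \<open>P j\<close>.\<close>

locale invariants_at =
  fixes C :: "nat \<Rightarrow> real^'n \<Rightarrow> real" and p :: "nat \<Rightarrow> real^'n \<Rightarrow> real^'n"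
    and P :: "nat \<Rightarrow> real^'n \<Rightarrow> real^'n" and k i :: nat and xe :: "real^'n"
  assumes grad: "j \<in> {1..k} \<Longrightarrow> GDERIV (C j) y :> p j y"
    and hess: "j \<in> {1..k} \<Longrightarrow> (p j has_derivative P j) (at xe)"
    and i: "i \<in> {1..k}"
begin

abbreviation "others \<equiv> {1..k} - {i}"

text \<open>The gradient and the Hessian form at \<open>xe\<close> of \<open>C i + (\<Sum>j. \<phi> j \<circ> C j)\<close>, where \<open>a j\<close> and \<open>b j\<close> are
  the first and second derivatives of \<open>\<phi> j\<close> at \<open>C j xe\<close>.\<close>

definition gradient_comb :: "(nat \<Rightarrow> real) \<Rightarrow> real^'n" where
  "gradient_comb a = p i xe + (\<Sum>j\<in>others. a j *\<^sub>R p j xe)"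

definition second_form :: "(nat \<Rightarrow> real) \<Rightarrow> (nat \<Rightarrow> real) \<Rightarrow> real^'n \<Rightarrow> real" where
  "second_form a b v =
     P i v \<bullet> v + (\<Sum>j\<in>others. a j * (P j v \<bullet> v) + b j * (v \<bullet> p j xe)\<^sup>2)"

definition combination :: "(nat \<Rightarrow> real \<Rightarrow> real) \<Rightarrow> real^'n \<Rightarrow> real" where
  "combination \<phi> = (\<lambda>x. C i x + (\<Sum>j\<in>others. (\<phi> j \<circ> C j) x))"

text \<open>The centre \<open>C j xe\<close> makes \<open>a j\<close> and \<open>b j\<close> the first and second derivatives there.\<close>

definition quad :: "(nat \<Rightarrow> real) \<Rightarrow> (nat \<Rightarrow> real) \<Rightarrow> nat \<Rightarrow> real \<Rightarrow> real" where
  "quad a b j t = a j * t + b j / 2 * (t - C j xe)\<^sup>2"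

lemma second_form_eq:
  "(P i v + (\<Sum>j\<in>others. a j *\<^sub>R P j v + (b j * (v \<bullet> p j xe)) *\<^sub>R p j xe)) \<bullet> v
    = second_form a b v"
  by (simp add: second_form_def inner_add_left inner_sum_left power2_eq_square
      inner_commute[of v] mult.assoc)

text \<open>The chain rule at work: first and second order conditions at \<open>xe\<close> see only \<open>a\<close> and \<open>b\<close>.\<close>

lemma
  fixes \<phi> \<phi>' \<phi>'' :: "nat \<Rightarrow> real \<Rightarrow> real"
  assumes \<phi>: "\<And>j t. j \<in> others \<Longrightarrow> DERIV (\<phi> j) t :> \<phi>' j t"
    and \<phi>': "\<And>j t. j \<in> others \<Longrightarrow> DERIV (\<phi>' j) t :> \<phi>'' j t"
  defines "a \<equiv> \<lambda>j. \<phi>' j (C j xe)" and "b \<equiv> \<lambda>j. \<phi>'' j (C j xe)"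
  shows combination_GDERIV:
      "GDERIV (combination \<phi>) y :> p i y + (\<Sum>j\<in>others. \<phi>' j (C j y) *\<^sub>R p j y)"
    and combination_gradient_has_derivative:
      "((\<lambda>y. p i y + (\<Sum>j\<in>others. \<phi>' j (C j y) *\<^sub>R p j y)) has_derivative
        (\<lambda>v. P i v + (\<Sum>j\<in>others. a j *\<^sub>R P j v + (b j * (v \<bullet> p j xe)) *\<^sub>R p j xe))) (at xe)"
    and combination_critical_iff: "GDERIV (combination \<phi>) xe :> 0 \<longleftrightarrow> gradient_comb a = 0"
    and combination_definite_iff:
      "pos_def_on W (hessian (combination \<phi>) xe) \<or> neg_def_on W (hessian (combination \<phi>) xe)
        \<longleftrightarrow> definite_on W (second_form a b)"
proof -
  show G: "GDERIV (combination \<phi>) y :> p i y + (\<Sum>j\<in>others. \<phi>' j (C j y) *\<^sub>R p j y)" for y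
    unfolding combination_def using i \<phi> by (intro composite_gradient grad) auto
  show dG: "((\<lambda>y. p i y + (\<Sum>j\<in>others. \<phi>' j (C j y) *\<^sub>R p j y)) has_derivative
        (\<lambda>v. P i v + (\<Sum>j\<in>others. a j *\<^sub>R P j v + (b j * (v \<bullet> p j xe)) *\<^sub>R p j xe))) (at xe)"
    unfolding a_def b_def using i \<phi>' by (intro composite_gradient_derivative hess grad) auto
  have "v \<bullet> (hessian (combination \<phi>) xe *v v) = second_form a b v" for v
    unfolding hessian_quadratic_form[OF G dG] by (rule second_form_eq)
  then show "pos_def_on W (hessian (combination \<phi>) xe) \<or> neg_def_on W (hessian (combination \<phi>) xe)
        \<longleftrightarrow> definite_on W (second_form a b)"
    unfolding definite_on_hessian_iff by simp
  show "GDERIV (combination \<phi>) xe :> 0 \<longleftrightarrow> gradient_comb a = 0"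
  proof
    show "gradient_comb a = 0" if "GDERIV (combination \<phi>) xe :> 0"
      unfolding gradient_comb_def a_def by (rule GDERIV_unique[OF G that])
    show "GDERIV (combination \<phi>) xe :> 0" if "gradient_comb a = 0"
      using G[of xe] that unfolding gradient_comb_def a_def by (simp only:)
  qed
qed

lemma quad_derivatives:
  "DERIV (quad a b j) t :> a j + b j * (t - C j xe)"
  "DERIV (\<lambda>t. a j + b j * (t - C j xe)) t :> b j"
  unfolding quad_def by (auto intro!: derivative_eq_intros)

lemma C2_quad: "C_class 2 (quad a b j)"
  by (rule C2_realI[OF quad_derivatives]) simp

lemma quad_combination_GDERIV:
  "GDERIV (combination (quad a b)) y
    :> p i y + (\<Sum>j\<in>others. (a j + b j * (C j y - C j xe)) *\<^sub>R p j y)"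
  by (rule combination_GDERIV[where \<phi>' = "\<lambda>j t. a j + b j * (t - C j xe)"])
    (rule quad_derivatives)+

lemma quad_combination_gradient_has_derivative:
  "((\<lambda>y. p i y + (\<Sum>j\<in>others. (a j + b j * (C j y - C j xe)) *\<^sub>R p j y)) has_derivative
    (\<lambda>v. P i v + (\<Sum>j\<in>others. a j *\<^sub>R P j v + (b j * (v \<bullet> p j xe)) *\<^sub>R p j xe))) (at xe)"
  using combination_gradient_has_derivative[of "quad a b" "\<lambda>j t. a j + b j * (t - C j xe)" "\<lambda>j t. b j"]
    quad_derivatives by simp

lemma quad_combination_critical_iff:
  "GDERIV (combination (quad a b)) xe :> 0 \<longleftrightarrow> gradient_comb a = 0"
  using combination_critical_iff[of "quad a b" "\<lambda>j t. a j + b j * (t - C j xe)" "\<lambda>j t. b j"]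
    quad_derivatives by simp

lemma quad_combination_definite_iff:
  "pos_def_on W (hessian (combination (quad a b)) xe) \<or> neg_def_on W (hessian (combination (quad a b)) xe)
    \<longleftrightarrow> definite_on W (second_form a b)"
  using combination_definite_iff[of "quad a b" "\<lambda>j t. a j + b j * (t - C j xe)" "\<lambda>j t. b j"]
    quad_derivatives by simp

lemma ker_d_C: "j \<in> others \<Longrightarrow> ker_d (C j) xe = {v. v \<bullet> p j xe = 0}"
  by (simp add: ker_d_def GDERIV_frechet[OF grad])

lemma ker_d_composite:
  assumes "j \<in> others" "\<And>t. DERIV \<phi> t :> \<phi>1 t"
  shows "ker_d (\<phi> \<circ> C j) xe = {v. \<phi>1 (C j xe) * (v \<bullet> p j xe) = 0}"
  using GDERIV_frechet[OF GDERIV_DERIV_compose[OF grad assms(2)], of j] assms(1)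
  by (simp add: ker_d_def o_def)

text \<open>The linear combination of (a) is the combination with the linear functions \<open>\<phi> j t = - lam j * t\<close>.\<close>

lemma condition_a_iff:
  "condition_a C k i xe \<longleftrightarrow> (\<exists>a. gradient_comb a = 0 \<and>
     definite_on {v. \<forall>j\<in>others. v \<bullet> p j xe = 0} (second_form a (\<lambda>_. 0)))" (is "_ \<longleftrightarrow> ?R")
proof -
  have W: "(\<Inter>j\<in>others. ker_d (C j) xe) = {v. \<forall>j\<in>others. v \<bullet> p j xe = 0}"
    using ker_d_C by auto
  have F: "(\<lambda>x. C i x - (\<Sum>j\<in>others. lam j * C j x))
      = combination (quad (\<lambda>j. - lam j) (\<lambda>_. 0))" for lam
    by (simp add: combination_def quad_def sum_negf)
  have "condition_a C k i xe \<longleftrightarrow> (\<exists>lam. gradient_comb (\<lambda>j. - lam j) = 0 \<and>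
     definite_on {v. \<forall>j\<in>others. v \<bullet> p j xe = 0} (second_form (\<lambda>j. - lam j) (\<lambda>_. 0)))"
    unfolding condition_a_def Let_def W F quad_combination_critical_iff quad_combination_definite_iff
    by (rule refl)
  also have "\<dots> \<longleftrightarrow> ?R"
  proof
    assume ?R
    then obtain a where "gradient_comb a = 0" "definite_on {v. \<forall>j\<in>others. v \<bullet> p j xe = 0} (second_form a (\<lambda>_. 0))"
      by blast
    then show "\<exists>lam. gradient_comb (\<lambda>j. - lam j) = 0 \<and>
     definite_on {v. \<forall>j\<in>others. v \<bullet> p j xe = 0} (second_form (\<lambda>j. - lam j) (\<lambda>_. 0))"
      by (intro exI[of _ "\<lambda>j. - a j"]) simp
  qed blast
  finally show ?thesis .
qed

text \<open>Quantifying over \<open>C\<^sup>2\<close> functions \<open>\<phi> j\<close> amounts to quantifying over the numbers \<open>a j\<close> and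
  \<open>b j\<close>, as \<open>quad a b\<close> realises any prescribed values. The subspace \<open>W \<phi>\<close> may depend on \<open>\<phi>\<close>
  through the first derivatives; this covers (b), where it is the whole space, and (c).\<close>

lemma ex_C2_combination_iff:
  assumes W: "\<And>\<phi> \<phi>'. (\<And>j t. j \<in> others \<Longrightarrow> DERIV (\<phi> j) t :> \<phi>' j t) \<Longrightarrow> W \<phi> = W' (\<lambda>j. \<phi>' j (C j xe))"
  shows "(\<exists>\<phi>. (\<forall>j\<in>others. C_class 2 (\<phi> j)) \<and> (GDERIV (combination \<phi>) xe :> 0) \<and>
      (pos_def_on (W \<phi>) (hessian (combination \<phi>) xe) \<or>
       neg_def_on (W \<phi>) (hessian (combination \<phi>) xe)))
    \<longleftrightarrow> (\<exists>a b. gradient_comb a = 0 \<and> definite_on (W' a) (second_form a b))"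
proof (intro iffI; elim exE conjE)
  fix \<phi> assume C2: "\<forall>j\<in>others. C_class 2 (\<phi> j)"
    and crit: "GDERIV (combination \<phi>) xe :> 0"
    and def: "pos_def_on (W \<phi>) (hessian (combination \<phi>) xe) \<or>
       neg_def_on (W \<phi>) (hessian (combination \<phi>) xe)"
  have "\<forall>j\<in>others. \<exists>\<phi>1 \<phi>2. (\<forall>t. DERIV (\<phi> j) t :> \<phi>1 t) \<and> (\<forall>t. DERIV \<phi>1 t :> \<phi>2 t)"
    using C2 C2_real_derivatives by metis
  then obtain \<phi>' \<phi>'' where
    d: "\<And>j t. j \<in> others \<Longrightarrow> DERIV (\<phi> j) t :> \<phi>' j t" "\<And>j t. j \<in> others \<Longrightarrow> DERIV (\<phi>' j) t :> \<phi>'' j t"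
    by metis
  have "gradient_comb (\<lambda>j. \<phi>' j (C j xe)) = 0"
    using crit combination_critical_iff[of \<phi> \<phi>' \<phi>''] d by blast
  moreover have "definite_on (W' (\<lambda>j. \<phi>' j (C j xe)))
      (second_form (\<lambda>j. \<phi>' j (C j xe)) (\<lambda>j. \<phi>'' j (C j xe)))"
    using def combination_definite_iff[of \<phi> \<phi>' \<phi>'' "W \<phi>"] d W[of \<phi> \<phi>'] by simp
  ultimately show "\<exists>a b. gradient_comb a = 0 \<and> definite_on (W' a) (second_form a b)" by blast
next
  fix a b assume "gradient_comb a = 0" "definite_on (W' a) (second_form a b)"
  moreover have "W (quad a b) = W' a"
    using W[of "quad a b" "\<lambda>j t. a j + b j * (t - C j xe)"] quad_derivatives(1) by simp
  ultimately show "\<exists>\<phi>. (\<forall>j\<in>others. C_class 2 (\<phi> j)) \<and> (GDERIV (combination \<phi>) xe :> 0) \<and>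
      (pos_def_on (W \<phi>) (hessian (combination \<phi>) xe) \<or>
       neg_def_on (W \<phi>) (hessian (combination \<phi>) xe))"
    by (intro exI[of _ "quad a b"])
      (simp add: C2_quad quad_combination_critical_iff quad_combination_definite_iff)
qed

lemma condition_b_iff:
  "condition_b C k i xe \<longleftrightarrow> (\<exists>a b. gradient_comb a = 0 \<and> definite_on UNIV (second_form a b))"
  using ex_C2_combination_iff[of "\<lambda>_. UNIV" "\<lambda>_. UNIV"]
  unfolding condition_b_def Let_def combination_def by simp

lemma condition_c_iff:
  "condition_c C k i xe \<longleftrightarrow> (\<exists>a b. gradient_comb a = 0 \<and>
     definite_on {v. \<forall>j\<in>others. a j * (v \<bullet> p j xe) = 0} (second_form a b))"
proof -
  have W: "(\<Inter>j\<in>others. ker_d (\<phi> j \<circ> C j) xe) = {v. \<forall>j\<in>others. \<phi>' j (C j xe) * (v \<bullet> p j xe) = 0}"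
    if d: "\<And>j t. j \<in> others \<Longrightarrow> DERIV (\<phi> j) t :> \<phi>' j t" for \<phi> \<phi>' :: "nat \<Rightarrow> real \<Rightarrow> real"
  proof -
    have "ker_d (\<phi> j \<circ> C j) xe = {v. \<phi>' j (C j xe) * (v \<bullet> p j xe) = 0}" if j: "j \<in> others" for j
      using j by (rule ker_d_composite) (rule d[OF j])
    then show ?thesis by auto
  qed
  show ?thesis
    using ex_C2_combination_iff[of "\<lambda>\<phi>. \<Inter>j\<in>others. ker_d (\<phi> j \<circ> C j) xe", OF W]
    unfolding condition_c_def Let_def combination_def .
qed

lemma bounded_linear_P: "j \<in> {1..k} \<Longrightarrow> bounded_linear (P j)"
  using hess has_derivative_bounded_linear by blast

text \<open>Finsler's lemma supplies a common second derivative for the \<open>\<phi> j\<close>; the first derivatives are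
  those of (a), so the point stays critical.\<close>

lemma a_imp_b:
  assumes "condition_a C k i xe"
  shows "condition_b C k i xe"
proof -
  obtain a \<sigma> where crit: "gradient_comb a = 0" and \<sigma>: "\<sigma> * \<sigma> = 1"
    and pos: "\<And>v. (\<And>j. j \<in> others \<Longrightarrow> v \<bullet> p j xe = 0) \<Longrightarrow> v \<noteq> 0 \<Longrightarrow> \<sigma> * second_form a (\<lambda>_. 0) v > 0"
    using assms unfolding condition_a_iff definite_on_def by auto
  define s where "s = (\<lambda>v. \<Sum>j\<in>others. (v \<bullet> p j xe)\<^sup>2)"
  have form: "second_form a (\<lambda>_. \<mu>) v = second_form a (\<lambda>_. 0) v + \<mu> * s v" for \<mu> v
    by (simp add: second_form_def s_def sum.distrib sum_distrib_left)
  have P: "continuous_on UNIV (P j)" "P j (c *\<^sub>R v) = c *\<^sub>R P j v" if "j \<in> {1..k}" for j c v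
    using bounded_linear_P[OF that] linear_continuous_on bounded_linear.linear linear_cmul by blast+
  have "\<exists>\<mu>. \<forall>v. v \<noteq> 0 \<longrightarrow> \<sigma> * second_form a (\<lambda>_. 0) v + \<mu> * s v > 0"
  proof (rule finsler)
    show "continuous_on UNIV (\<lambda>v. \<sigma> * second_form a (\<lambda>_. 0) v)"
      unfolding second_form_def using i by (intro continuous_intros P) auto
    show "continuous_on UNIV s" unfolding s_def by (intro continuous_intros)
    show "\<sigma> * second_form a (\<lambda>_. 0) (c *\<^sub>R v) = c\<^sup>2 * (\<sigma> * second_form a (\<lambda>_. 0) v)" for c v
      using i by (simp add: second_form_def P power2_eq_square sum_distrib_left algebra_simps)
    show "s (c *\<^sub>R v) = c\<^sup>2 * s v" for c v
      by (simp add: s_def power_mult_distrib sum_distrib_left)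
    show "s v \<ge> 0" for v unfolding s_def by (intro sum_nonneg) auto
    show "\<sigma> * second_form a (\<lambda>_. 0) v > 0" if "v \<noteq> 0" "s v = 0" for v
      using that by (intro pos) (auto simp: s_def sum_nonneg_eq_0_iff)
  qed
  then obtain \<mu> where \<mu>: "\<And>v. v \<noteq> 0 \<Longrightarrow> \<sigma> * second_form a (\<lambda>_. 0) v + \<mu> * s v > 0"
    by blast
  \<comment> \<open>The factor \<open>\<sigma>\<close> gives the penalty term the sign of the form; it cancels as \<open>\<sigma> * \<sigma> = 1\<close>.\<close>
  have "\<sigma> * second_form a (\<lambda>_. \<sigma> * \<mu>) v = \<sigma> * second_form a (\<lambda>_. 0) v + (\<sigma> * \<sigma>) * (\<mu> * s v)" for v
    by (subst form) (simp add: algebra_simps)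
  then have "definite_on UNIV (second_form a (\<lambda>_. \<sigma> * \<mu>))"
    unfolding definite_on_def using \<mu> \<sigma> by auto
  then show ?thesis using crit condition_b_iff by blast
qed

lemma b_imp_c: "condition_b C k i xe \<Longrightarrow> condition_c C k i xe"
  unfolding condition_b_iff condition_c_iff using definite_on_mono[OF _ subset_UNIV] by blast

lemma c_imp_a:
  assumes "condition_c C k i xe"
  shows "condition_a C k i xe"
proof -
  obtain a b where crit: "gradient_comb a = 0"
    and "definite_on {v. \<forall>j\<in>others. a j * (v \<bullet> p j xe) = 0} (second_form a b)"
    using assms unfolding condition_c_iff by blast
  then have "definite_on {v. \<forall>j\<in>others. v \<bullet> p j xe = 0} (second_form a b)"
    by (elim definite_on_mono) auto
  also have "?this \<longleftrightarrow> definite_on {v. \<forall>j\<in>others. v \<bullet> p j xe = 0} (second_form a (\<lambda>_. 0))"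
    by (intro definite_on_cong) (simp add: second_form_def)
  finally show ?thesis using crit condition_a_iff by blast
qed

text \<open>With the sign \<open>\<sigma>\<close> of the definite Hessian, \<open>\<sigma> * G\<close> is a conserved Lyapunov function. Its
  gradient is orthogonal to \<open>f\<close> at every point because those of the \<open>C j\<close> are.\<close>

lemma b_imp_stable:
  assumes b: "condition_b C k i xe" and f: "C_class 1 f" "f xe = 0"
    and orth: "\<And>j y. j \<in> {1..k} \<Longrightarrow> f y \<bullet> p j y = 0"
  shows "nonlinearly_stable_equilibrium f xe"
proof -
  obtain a b \<sigma> where crit: "gradient_comb a = 0"
    and pos: "\<And>v. v \<noteq> 0 \<Longrightarrow> \<sigma> * second_form a b v > 0"
    using b unfolding condition_b_iff definite_on_def by auto
  let ?G = "combination (quad a b)"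
  let ?g = "\<lambda>y. p i y + (\<Sum>j\<in>others. (a j + b j * (C j y - C j xe)) *\<^sub>R p j y)"
  let ?Q = "\<lambda>v. P i v + (\<Sum>j\<in>others. a j *\<^sub>R P j v + (b j * (v \<bullet> p j xe)) *\<^sub>R p j xe)"
  have G: "GDERIV (\<lambda>x. \<sigma> * ?G x) y :> \<sigma> *\<^sub>R ?g y" for y
    using has_derivative_mult_right[OF quad_combination_GDERIV[of a b, unfolded gderiv_def], of \<sigma>]
    by (simp add: gderiv_def)
  have g: "((\<lambda>y. \<sigma> *\<^sub>R ?g y) has_derivative (\<lambda>v. \<sigma> *\<^sub>R ?Q v)) (at xe)"
    by (intro has_derivative_scaleR_right quad_combination_gradient_has_derivative)
  have "\<sigma> *\<^sub>R ?Q v \<bullet> v > 0" if "v \<noteq> 0" for v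
    using pos[OF that] second_form_eq[of v a b] by simp
  moreover have "\<sigma> *\<^sub>R ?g xe = 0" using crit by (simp add: gradient_comb_def)
  ultimately obtain r where r: "r > 0" "\<And>y. y \<noteq> xe \<Longrightarrow> dist y xe < r \<Longrightarrow> \<sigma> * ?G xe < \<sigma> * ?G y"
    using strict_local_minimum[OF G _ g] by blast
  have "f y \<bullet> (\<sigma> *\<^sub>R ?g y) = 0" for y
    using i orth by (simp add: inner_add_right inner_sum_right)
  then show ?thesis using lyapunov_stability[OF f G _ r] by blast
qed

end

section \<open>Equivalence and stability\<close>

theorem theorem2p2:
  fixes f :: "real^'n \<Rightarrow> real^'n"
    and xe :: "real^'n"
    and C :: "nat \<Rightarrow> real^'n \<Rightarrow> real"
    and k i :: nat
  assumes "smooth f"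
    and "f xe = 0"
    and "\<And>j. j \<in> {1..k} \<Longrightarrow> C_class 2 (C j)"
    and "\<And>j. j \<in> {1..k} \<Longrightarrow> constant_of_motion f (C j)"
    and "i \<in> {1..k}"
  shows "(condition_a C k i xe \<longleftrightarrow> condition_b C k i xe) \<and>
         (condition_b C k i xe \<longleftrightarrow> condition_c C k i xe) \<and>
         (condition_a C k i xe \<longrightarrow> nonlinearly_stable_equilibrium f xe) \<and>
         (condition_b C k i xe \<longrightarrow> nonlinearly_stable_equilibrium f xe) \<and>
         (condition_c C k i xe \<longrightarrow> nonlinearly_stable_equilibrium f xe)"
proof -
  have "\<forall>j\<in>{1..k}. \<exists>p P. (\<forall>y. GDERIV (C j) y :> p y) \<and> (p has_derivative P) (at xe)"
    using C2_gradient[OF assms(3)] by metis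
  then obtain p P where p: "\<And>j y. j \<in> {1..k} \<Longrightarrow> GDERIV (C j) y :> p j y"
    and P: "\<And>j. j \<in> {1..k} \<Longrightarrow> (p j has_derivative P j) (at xe)"
    by metis
  interpret invariants_at C p P k i xe
    using p P assms(5) by unfold_locales
  have f: "C_class 1 f" using assms(1) by (simp only: smooth_def)
  have "f y \<bullet> p j y = 0" if "j \<in> {1..k}" for j y
    using assms(4)[OF that] GDERIV_frechet[OF p[OF that]] by (simp add: constant_of_motion_def)
  then have "condition_b C k i xe \<Longrightarrow> nonlinearly_stable_equilibrium f xe"
    using b_imp_stable f assms(2) by blast
  then show ?thesis using a_imp_b b_imp_c c_imp_a by blast
qed

end
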